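(* Let $\phi : [0,2] \times \mathbb{R} \to \mathbb{R}$ be a continuous map, write $\phi_c(x) = \phi(c,x)$, and regard $\phi_c$ as a one-parameter family of continuous maps $\mathbb{R} \to \mathbb{R}$ with parameter $c \in [0,2]$. Assume that (a) $\phi_c(0) > 0$ for all $0 \le c \le 2$; (b) there exists a smallest integer $r \ge 2$ such that $\phi_{\hat c}^{r}(0) = 0$ for some parameter $0 \le \hat c < 2$; and (c) $\phi_2^{n}(0) < 0$ for all integers $n \ge 2$. Let $\hat r = \max\{3, r\}$ and, for each integer $n \ge 2$, let $\Phi_n(c) = \phi_c^{n}(0)$ for $c \in [0,2]$. For each integer $\ell \ge r$, let $c_\ell^*$ be the largest solution in $[0,2]$ of the equation $\Phi_\ell(c) = 0$. For each integer $k \ge \hat r$, define integers $a_{k,j}$ ($j \ge k$) by $$a_{k,k} = 1 = a_{k,k+1}, \qquad a_{k,k+i} = 2^{i-2} \ \text{ for } 2 \le i \le k-1, \qquad a_{k,2k} = 2^{k-2} - 1,$$ and, for each integer $j > 2k$, $$a_{k,j} = \sum_{1 \le i \le k-1} a_{k,j-i}.$$ Also let $N_{\hat r} = N_{\hat r + 1} = 1$ and $N_m = \sum_{k=\hat r}^{m-1} a_{k,m}$ for all integers $m \ge \hat r + 2$. Then the following hold: (1) $0 \le c_r^* < c_{r+1}^* < c_{r+2}^* < \cdots < 2$ (in particular, each $c_\ell^*$, $\ell \ge r$, exists). (2) For every fixed integer $k \ge \hat r$ and every integer $i \ge 0$, there are at least $a_{k,k+i}$ distinct parameters $c$ in the interval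 $[c_k^*, c_{k+1}^*]$ such that $\phi_{c}^{k+i}(0) = 0$. (3) For each integer $n \ge \hat r$, there are at least $N_n$ distinct parameters $c \in [0,2]$ such that the point $x = 0$ is a periodic point of $\phi_c$ whose least period divides $n$; and $$\liminf_{n \to \infty} \frac{\log N_n}{n} \ge \log 2.$$
   Context: For a map $g : \mathbb{R} \to \mathbb{R}$ and an integer $n \ge 1$, $g^n$ denotes the $n$-fold composition of $g$ with itself; thus $\phi_c^n$ is the $n$-th iterate of $\phi_c$ with $c$ held fixed. A point $x$ is a periodic point of $g$ if $g^m(x) = x$ for some $m \ge 1$, and its least period is the smallest such $m$; so $x=0$ is a periodic point of $\phi_c$ whose least period divides $n$ if and only if $\phi_c^n(0) = 0$. In hypothesis (b), $r$ is the smallest integer $n \ge 2$ for which the equation $\phi_c^n(0) = 0$ has a solution $c \in [0,2)$. $\log$ is the natural logarithm. *)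

theory Defs
  imports Complex_Main "HOL-Library.Extended_Real"
begin

definition periodic_point :: "('a \<Rightarrow> 'a) \<Rightarrow> 'a \<Rightarrow> bool" where
  "periodic_point g x \<longleftrightarrow> (\<exists>m::nat. m \<ge> 1 \<and> (g ^^ m) x = x)"

(* meaningful only when periodic_point g x holds *)
definition least_period :: "('a \<Rightarrow> 'a) \<Rightarrow> 'a \<Rightarrow> nat" where
  "least_period g x = (LEAST m::nat. m \<ge> 1 \<and> (g ^^ m) x = x)"

definition Phi :: "(real \<Rightarrow> real \<Rightarrow> real) \<Rightarrow> nat \<Rightarrow> real \<Rightarrow> real" where
  "Phi \<phi> n c = (\<phi> c ^^ n) 0"

definition Phi_zeros :: "(real \<Rightarrow> real \<Rightarrow> real) \<Rightarrow> nat \<Rightarrow> real set" where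
  "Phi_zeros \<phi> n = {c \<in> {0..2}. Phi \<phi> n c = 0}"

(* Unspecified unless the zero set has a greatest element; that it has one must be
   stated separately. *)
definition c_star :: "(real \<Rightarrow> real \<Rightarrow> real) \<Rightarrow> nat \<Rightarrow> real" where
  "c_star \<phi> l = (GREATEST c. c \<in> Phi_zeros \<phi> l)"

(* Only used for k \<ge> 3 and j \<ge> k, where no subtraction on nat truncates and
   j = k + i in the third branch has 2 \<le> i \<le> k - 1. The value 0 for j < k is a
   dummy which the recursion never reaches from j \<ge> k. *)
fun a_seq :: "nat \<Rightarrow> nat \<Rightarrow> nat" where
  "a_seq k j =
     (if j < k then 0
      else if j = k \<or> j = k + 1 then 1
      else if j < 2 * k then 2 ^ (j - k - 2)
      else if j = 2 * k then 2 ^ (k - 2) - 1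
      else (\<Sum>i\<in>{1..k - 1}. a_seq k (j - i)))"

declare a_seq.simps [simp del]

(* s is the starting index; the value for m < s is an irrelevant 0 *)
definition N_seq :: "nat \<Rightarrow> nat \<Rightarrow> nat" where
  "N_seq s m = (if m = s \<or> m = s + 1 then 1 else (\<Sum>k\<in>{s..<m}. a_seq k m))"

(* Phrased without card A, since card A = 0 for infinite A. *)
definition has_at_least :: "nat \<Rightarrow> 'a set \<Rightarrow> bool" where
  "has_at_least n A \<longleftrightarrow> (\<exists>S. S \<subseteq> A \<and> finite S \<and> card S = n)"

end

theory Submission
  imports Defs
begin

text \<open>
  If \<open>Phi n c = 0\<close> then \<open>Phi (n + j) c = Phi j c\<close>. For \<open>c\<close> in \<open>(c*_k, c*_(k+1)]\<close> this makes
  \<open>Phi (n + 1)\<close> positive and \<open>Phi (n + 2), \<dots>, Phi (n + k)\<close> negative at \<open>c\<close>. So as \<open>n\<close> grows,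
  a zero born at time \<open>n\<close> faces a neighbouring zero born up to \<open>k - 1\<close> steps earlier, a sign
  change at time \<open>n + 1\<close> creates a new zero strictly between them, and each of the two halves
  repeats the pattern. The count satisfies the \<open>(k - 1)\<close>-step Fibonacci recurrence. At the end
  point \<open>c*_k\<close> itself \<open>Phi k\<close> vanishes instead of being negative, which costs one zero at
  time \<open>2 * k\<close> and explains \<open>a_(k,2k) = 2^(k-2) - 1\<close>.

  The growth rate of this recurrence is at least any \<open>t < 2\<close> with
  \<open>1/t + \<dots> + 1/t^(k-1) \<ge> 1\<close>, which holds for all large \<open>k\<close>; already a single summand
  \<open>a_(k,n)\<close> of \<open>N_n\<close> therefore gives the bound on the liminf.
\<close>

section \<open>Calculus of lower bounds on cardinality\<close>

lemma has_at_least_0 [simp]: "has_at_least 0 A"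
  unfolding has_at_least_def by (intro exI[of _ "{}"]) auto

lemma has_at_least_1: "x \<in> A \<Longrightarrow> has_at_least 1 A"
  unfolding has_at_least_def by (intro exI[of _ "{x}"]) auto

lemma has_at_least_mono: "has_at_least n A \<Longrightarrow> A \<subseteq> B \<Longrightarrow> has_at_least n B"
  unfolding has_at_least_def by blast

lemma has_at_least_Un:
  assumes "has_at_least m A" "has_at_least n B" "A \<inter> B = {}"
  shows "has_at_least (m + n) (A \<union> B)"
proof -
  obtain S T where "S \<subseteq> A" "finite S" "card S = m" "T \<subseteq> B" "finite T" "card T = n"
    using assms unfolding has_at_least_def by metis
  with assms(3) show ?thesis
    unfolding has_at_least_def
    by (intro exI[of _ "S \<union> T"]) (auto intro!: card_Un_disjoint)
qed

lemma has_at_least_UN: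
  assumes "finite I"
    and "\<And>i. i \<in> I \<Longrightarrow> has_at_least (f i) (A i)"
    and "\<And>i j. i \<in> I \<Longrightarrow> j \<in> I \<Longrightarrow> i \<noteq> j \<Longrightarrow> A i \<inter> A j = {}"
  shows "has_at_least (sum f I) (\<Union>i\<in>I. A i)"
  using assms
proof (induction I rule: finite_induct)
  case empty
  then show ?case by simp
next
  case (insert x F)
  have "has_at_least (f x + sum f F) (A x \<union> (\<Union>i\<in>F. A i))"
  proof (rule has_at_least_Un)
    show "A x \<inter> (\<Union>i\<in>F. A i) = {}"
      using insert.hyps insert.prems(2) by blast
  qed (use insert in auto)
  then show ?case
    using insert.hyps by simp
qed

section \<open>Counting zeros between two points\<close>

text \<open>With \<open>K = k - 1\<close>, this bounds the zeros of \<open>Phi (n + i)\<close> between a zero of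
  \<open>Phi n\<close> and a point at which \<open>Phi (n + 1), \<dots>, Phi (n + m)\<close> are negative.\<close>

fun zero_count :: "nat \<Rightarrow> nat \<Rightarrow> nat \<Rightarrow> nat" where
  "zero_count K 0 i = 0"
| "zero_count K (Suc m) 0 = 0"
| "zero_count K (Suc m) (Suc i) = (if i = 0 then 1 else zero_count K K i) + zero_count K m i"

lemma zero_count_0_right [simp]: "zero_count K m 0 = 0"
  by (cases m) auto

text \<open>Unrolls the recursion in \<open>m\<close>: the half next to the negative point sheds one
  new zero at each step \<open>s\<close>, until \<open>m\<close> or \<open>i\<close> is used
  up.\<close>

lemma zero_count_eq_sum:
  "zero_count K m i =
    (\<Sum>s = 1..min m i. if i - s = 0 then 1 else zero_count K K (i - s))"
proof (induction m arbitrary: i)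
  case 0
  then show ?case by simp
next
  case (Suc m)
  show ?case
  proof (cases i)
    case 0
    then show ?thesis by simp
  next
    case (Suc i')
    let ?g = "\<lambda>s. if i - s = 0 then 1 else zero_count K K (i - s)"
    have "(\<Sum>s = 1..min (Suc m) i. ?g s) = ?g 1 + (\<Sum>s = Suc 1..Suc (min m i'). ?g s)"
      using Suc by (subst sum.atLeast_Suc_atMost) auto
    also have "\<dots> = ?g 1 + (\<Sum>s = 1..min m i'. ?g (Suc s))"
      by (subst sum.shift_bounds_cl_Suc_ivl) simp
    also have "\<dots> = zero_count K (Suc m) i"
      using Suc.IH[of i'] by (simp add: Suc cong: if_cong)
    finally show ?thesis ..
  qed
qed

text \<open>Unfold every summand once. The first parts add up to \<open>zero_count K K j\<close> by
  \<open>zero_count_eq_sum\<close>, the second parts to \<open>zero_count K m j\<close> by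
  induction.\<close>

lemma zero_count_recurrence:
  "m < i \<Longrightarrow> zero_count K m i = (\<Sum>s = 1..K. zero_count K m (i - s))"
proof (induction m arbitrary: i)
  case 0
  then show ?case by simp
next
  case (Suc m)
  then obtain j where j: "i = Suc j" "m < j"
    by (cases i) auto
  let ?f = "\<lambda>l. if l = 0 then 1 else zero_count K K l"
  \<comment> \<open>For \<open>s \<le> j\<close> the argument \<open>i - s\<close> is a successor
    and unfolds; beyond that, subtraction truncates to 0 and the terms vanish.\<close>
  have cut: "(\<Sum>s = 1..K. h s) = (\<Sum>s = 1..min K j. h s)" if "\<And>s. j < s \<Longrightarrow> h s = 0"
    for h :: "nat \<Rightarrow> nat"
    by (rule sum.mono_neutral_right) (use that in auto)
  have "(\<Sum>s = 1..K. zero_count K (Suc m) (i - s))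
      = (\<Sum>s = 1..min K j. zero_count K (Suc m) (i - s))"
    using j by (intro cut) auto
  also have "\<dots> = (\<Sum>s = 1..min K j. ?f (j - s) + zero_count K m (j - s))"
    by (rule sum.cong) (auto simp: j Suc_diff_le)
  also have "\<dots> = zero_count K K j + (\<Sum>s = 1..min K j. zero_count K m (j - s))"
    using zero_count_eq_sum[of K K j] by (simp add: sum.distrib)
  also have "(\<Sum>s = 1..min K j. zero_count K m (j - s)) = (\<Sum>s = 1..K. zero_count K m (j - s))"
    by (rule cut[symmetric]) auto
  also have "\<dots> = zero_count K m j"
    using Suc.IH[OF j(2)] by simp
  finally show ?case
    using j by simp
qed

text \<open>Until the \<open>m\<close> negative values run out, both halves hold equally many zeros,
  so the count doubles.\<close>

lemma zero_count_power: "0 < i \<Longrightarrow> i \<le> m \<Longrightarrow> m \<le> K \<Longrightarrow> zero_count K m i = 2 ^ (i - 1)"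
proof (induction i arbitrary: m)
  case 0
  then show ?case by simp
next
  case (Suc i)
  then obtain m' where m': "m = Suc m'"
    by (cases m) auto
  show ?case
  proof (cases "i = 0")
    case False
    then obtain i' where "i = Suc i'"
      by (cases i) auto
    then show ?thesis
      using Suc.IH[of K] Suc.IH[of m'] Suc.prems m' by simp
  qed (simp add: m')
qed

(* The first index at which the count falls short of the powers of two: j = 2k in a_seq. *)
lemma zero_count_diagonal: "m \<le> K \<Longrightarrow> zero_count K m (Suc m) = 2 ^ m - 1"
proof (induction m)
  case 0
  then show ?case by simp
next
  case (Suc m)
  have "(1::nat) \<le> 2 ^ m" by simp
  then show ?case
    using Suc zero_count_power[of "Suc m" K K] by simp
qed

text \<open>The count starts from the zero \<open>c*_(k+1)\<close> of \<open>Phi (k + 1)\<close>,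
  hence the shift by \<open>k + 1\<close>. The three cases match the last three branches of
  \<open>a_seq\<close>.\<close>

lemma a_seq_eq_zero_count:
  assumes "3 \<le> k" "0 < i"
  shows "a_seq k (k + 1 + i) = zero_count (k - 1) (k - 2) i"
  using assms(2)
proof (induction i rule: less_induct)
  case (less i)
  consider "i < k - 1" | "i = k - 1" | "k - 1 < i"
    by linarith
  then show ?case
  proof cases
    case 1
    then show ?thesis
      using less.prems by (subst a_seq.simps) (auto simp: zero_count_power)
  next
    case 2
    then have "i = Suc (k - 2)"
      using assms by simp
    then show ?thesis
      using assms zero_count_diagonal[of "k - 2" "k - 1"] by (subst a_seq.simps) auto
  next
    case 3
    \<comment> \<open>Since \<open>s \<le> k - 1 < i\<close>, all indices on the right exceed
      \<open>k + 1\<close>, so the induction hypothesis covers them.\<close>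
    have "a_seq k (k + 1 + i) = (\<Sum>s = 1..k - 1. a_seq k (k + 1 + i - s))"
      using 3 assms by (subst a_seq.simps) auto
    also have "\<dots> = (\<Sum>s = 1..k - 1. zero_count (k - 1) (k - 2) (i - s))"
    proof (rule sum.cong)
      fix s assume "s \<in> {1..k - 1}"
      moreover from this have "k + 1 + i - s = k + 1 + (i - s)"
        using 3 by auto
      ultimately show "a_seq k (k + 1 + i - s) = zero_count (k - 1) (k - 2) (i - s)"
        using less.IH[of "i - s"] 3 by auto
    qed simp
    also have "\<dots> = zero_count (k - 1) (k - 2) i"
      using 3 zero_count_recurrence[of "k - 2" i "k - 1"] by auto
    finally show ?thesis .
  qed
qed

section \<open>Zeros forced by sign changes\<close>

lemma zero_between:
  fixes f :: "real \<Rightarrow> real"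
  assumes "f u > 0" "f v < 0" "continuous_on {min u v..max u v} f"
  shows "\<exists>z. min u v < z \<and> z < max u v \<and> f z = 0"
proof (cases "u \<le> v")
  case True
  then obtain z where "u \<le> z" "z \<le> v" "f z = 0"
    using IVT2'[of f v 0 u] assms by auto
  with assms True show ?thesis
    by (intro exI[of _ z]) (auto simp: order_less_le)
next
  case False
  then obtain z where "v \<le> z" "z \<le> u" "f z = 0"
    using IVT'[of f v 0 u] assms by auto
  with assms False show ?thesis
    by (intro exI[of _ z]) (auto simp: order_less_le)
qed

text \<open>Induction on \<open>i\<close>, splitting at a new zero \<open>z\<close> of
  \<open>F (Suc n)\<close>. The interval is open at \<open>p\<close> because \<open>v\<close> may be
  \<open>p\<close>, where \<open>pos\<close> and \<open>neg\<close> are not assumed; each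
  \<open>z\<close> lies strictly inside.\<close>

lemma zeros_between:
  fixes F :: "nat \<Rightarrow> real \<Rightarrow> real"
  assumes cont: "\<And>n. continuous_on {p..q} (F n)"
    and pos: "\<And>n x. x \<in> {p<..q} \<Longrightarrow> F n x = 0 \<Longrightarrow> F (Suc n) x > 0"
    and neg: "\<And>n x s. x \<in> {p<..q} \<Longrightarrow> F n x = 0 \<Longrightarrow> s \<in> {1..K} \<Longrightarrow> F (Suc n + s) x < 0"
    and "u \<in> {p<..q}" "v \<in> {p..q}" "F n u = 0"
    and "\<And>s. s \<in> {1..m} \<Longrightarrow> F (n + s) v < 0"
  shows "has_at_least (zero_count K m i) {x \<in> {min u v<..<max u v}. F (n + i) x = 0}"
  using assms(4-)
proof (induction i arbitrary: m n u v)
  case 0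
  then show ?case by simp
next
  case (Suc i)
  show ?case
  proof (cases m)
    case 0
    then show ?thesis by simp
  next
    case m: (Suc m')
    have "F (Suc n) v < 0"
      using Suc.prems(4)[of 1] m by simp
    moreover have "F (Suc n) u > 0"
      using Suc.prems pos by blast
    moreover have "continuous_on {min u v..max u v} (F (Suc n))"
      by (rule continuous_on_subset[OF cont]) (use Suc.prems in auto)
    ultimately obtain z where z: "min u v < z" "z < max u v" "F (Suc n) z = 0"
      using zero_between by metis
    have zJ: "z \<in> {p<..q}"
      using z Suc.prems by auto
    show ?thesis
    proof (cases "i = 0")
      case True
      then show ?thesis
        using has_at_least_1[of z] z m by simp
    next
      case False
      let ?Z = "\<lambda>u v. {x \<in> {min u v<..<max u v}. F (Suc n + i) x = 0}"
      \<comment> \<open>Here \<open>u\<close> changes role: by \<open>neg\<close> it becomes the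
        negative point, with a fresh supply of \<open>K\<close> negative values.\<close>
      have "has_at_least (zero_count K K i) (?Z z u)"
        using zJ z Suc.prems neg by (intro Suc.IH) auto
      \<comment> \<open>Here \<open>v\<close> stays the negative point, with one negative value
        spent.\<close>
      moreover have "has_at_least (zero_count K m' i) (?Z z v)"
      proof (intro Suc.IH)
        show "F (Suc n + s) v < 0" if "s \<in> {1..m'}" for s
          using Suc.prems(4)[of "Suc s"] that m by simp
      qed (use zJ z Suc.prems in auto)
      moreover have "?Z z u \<inter> ?Z z v = {}"
        using z by (auto simp: min_def max_def split: if_splits)
      ultimately have "has_at_least (zero_count K m (Suc i)) (?Z z u \<union> ?Z z v)"
        using has_at_least_Un False m by fastforce
      then show ?thesis
        by (rule has_at_least_mono) (use z in \<open>auto simp: min_def max_def split: if_splits\<close>)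
    qed
  qed
qed

section \<open>Growth of the lower bounds\<close>

lemma a_seq_ge_1:
  assumes "3 \<le> k" "k \<le> j" "j \<le> 2 * k"
  shows "1 \<le> a_seq k j"
proof -
  \<comment> \<open>This keeps the exceptional value \<open>2 ^ (k - 2) - 1\<close> at
    \<open>j = 2 * k\<close> positive.\<close>
  have "(2::nat) ^ 1 \<le> 2 ^ (k - 2)"
    using assms by (intro power_increasing) auto
  then show ?thesis
    using assms by (subst a_seq.simps) auto
qed

text \<open>Dividing by \<open>t ^ (2 * k)\<close> makes the bound at most 1 on the initial range;
  the assumption on the sum then carries it through the recurrence.\<close>

lemma a_seq_growth:
  fixes t :: real
  assumes "3 \<le> k" "1 \<le> t" "1 \<le> (\<Sum>i = 1..k - 1. (1 / t) ^ i)" "k \<le> j"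
  shows "t ^ j / t ^ (2 * k) \<le> real (a_seq k j)"
  using assms(4)
proof (induction j rule: less_induct)
  case (less j)
  show ?case
  proof (cases "j \<le> 2 * k")
    case True
    have "t ^ j / t ^ (2 * k) \<le> 1"
      using assms True by (simp add: power_increasing)
    also have "\<dots> \<le> real (a_seq k j)"
      using a_seq_ge_1[of k j] assms True less.prems by simp
    finally show ?thesis .
  next
    case False
    have "t ^ j / t ^ (2 * k) * 1 \<le> t ^ j / t ^ (2 * k) * (\<Sum>i = 1..k - 1. (1 / t) ^ i)"
      using assms by (intro mult_left_mono) auto
    also have "\<dots> = (\<Sum>i = 1..k - 1. t ^ (j - i) / t ^ (2 * k))"
      unfolding sum_distrib_left
      by (rule sum.cong) (use assms False in \<open>auto simp: power_diff power_one_over\<close>)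
    also have "\<dots> \<le> (\<Sum>i = 1..k - 1. real (a_seq k (j - i)))"
      by (rule sum_mono) (use less.IH False assms in auto)
    also have "\<dots> = real (a_seq k j)"
      using False assms(1) by (subst (2) a_seq.simps) auto
    finally show ?thesis by simp
  qed
qed

lemma geometric_sum_ge_1:
  fixes q :: real
  assumes "1 / 2 < q" "q < 1"
  shows "eventually (\<lambda>k. 1 \<le> (\<Sum>i = 1..k - 1. q ^ i)) sequentially"
proof -
  have "(\<lambda>n. q ^ n) sums (1 / (1 - q))"
    using assms by (intro geometric_sums) auto
  then have lim: "(\<lambda>n. \<Sum>i<n. q ^ i) \<longlonglongrightarrow> 1 / (1 - q)"
    by (simp add: sums_def)
  \<comment> \<open>The threshold is 2 because this series also contains the term 1 at index
    0.\<close>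
  have "2 < 1 / (1 - q)"
    using assms by (simp add: field_simps)
  with lim have "eventually (\<lambda>n. 2 < (\<Sum>i<n. q ^ i)) sequentially"
    by (rule order_tendstoD(1))
  then show ?thesis
    using eventually_ge_at_top[of 1]
  proof eventually_elim
    case (elim k)
    then have "{..<k} = insert 0 {1..k - 1}"
      by auto
    with elim show ?case by simp
  qed
qed

lemma liminf_N_seq:
  assumes "3 \<le> s"
  shows "ereal (ln 2) \<le> liminf (\<lambda>n. ereal (ln (real (N_seq s n)) / real n))"
  unfolding le_Liminf_iff
proof (intro allI impI)
  fix y assume "y < ereal (ln 2)"
  \<comment> \<open>Taking \<open>max y 0\<close> forces \<open>x > 0\<close>, hence
    \<open>t > 1\<close>.\<close>
  then have "max y 0 < ereal (ln 2)"
    by simp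
  then obtain x where x: "max y 0 < ereal x" "x < ln 2"
    using ereal_dense2 by (metis less_ereal.simps(1))
  define t where "t = exp x"
  have "0 < x" "y < ereal x"
    using x by auto
  moreover have "exp x < exp (ln 2)"
    using x by (subst exp_less_cancel_iff)
  ultimately have t: "1 < t" "t < 2" "ln t = x"
    by (auto simp: t_def)
  then have "eventually (\<lambda>k. 1 \<le> (\<Sum>i = 1..k - 1. (1 / t) ^ i)) sequentially"
    by (intro geometric_sum_ge_1) (auto simp: field_simps)
  then obtain k where k: "s \<le> k" "1 \<le> (\<Sum>i = 1..k - 1. (1 / t) ^ i)"
    unfolding eventually_sequentially by (metis nle_le order_refl)
  \<comment> \<open>With \<open>k\<close> fixed, this is
    \<open>ln (t ^ n / t ^ (2 * k)) / n\<close>.\<close>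
  have "(\<lambda>n. x - 2 * real k * x / real n) \<longlonglongrightarrow> x - 0"
    by (intro tendsto_intros lim_const_over_n)
  then have "(\<lambda>n. ereal (x - 2 * real k * x / real n)) \<longlonglongrightarrow> ereal x"
    by simp
  then have "eventually (\<lambda>n. y < ereal (x - 2 * real k * x / real n)) sequentially"
    using \<open>y < ereal x\<close> by (rule order_tendstoD(1))
  then show "eventually (\<lambda>n. y < ereal (ln (real (N_seq s n)) / real n)) sequentially"
    \<comment> \<open>Then \<open>n \<ge> s + 2\<close>, so \<open>N_seq s n\<close> is the sum, and
      \<open>a_seq k n\<close> is one of its terms.\<close>
    using eventually_gt_at_top[of "k + 1"]
  proof eventually_elim
    case (elim n)
    have "a_seq k n \<le> (\<Sum>k\<in>{s..<n}. a_seq k n)"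
      using elim k by (intro member_le_sum) auto
    also have "\<dots> = N_seq s n"
      using elim k by (simp add: N_seq_def)
    finally have "real (a_seq k n) \<le> real (N_seq s n)"
      by simp
    moreover have "t ^ n / t ^ (2 * k) \<le> real (a_seq k n)"
      using a_seq_growth[of k t n] k t assms elim by simp
    ultimately have le: "t ^ n / t ^ (2 * k) \<le> real (N_seq s n)"
      by simp
    have "0 < t ^ n / t ^ (2 * k)"
      using t by simp
    with le have "ln (t ^ n / t ^ (2 * k)) \<le> ln (real (N_seq s n))"
      by (subst ln_le_cancel_iff) auto
    moreover have "ln (t ^ n / t ^ (2 * k)) = real n * x - 2 * real k * x"
      using t by (simp add: ln_div ln_realpow)
    ultimately have "(real n * x - 2 * real k * x) / real n \<le> ln (real (N_seq s n)) / real n"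
      by (intro divide_right_mono) auto
    moreover have "(real n * x - 2 * real k * x) / real n = x - 2 * real k * x / real n"
      using elim by (simp add: field_simps)
    ultimately have "ereal (x - 2 * real k * x / real n) \<le> ereal (ln (real (N_seq s n)) / real n)"
      by simp
    with elim show ?case
      by (meson less_le_trans)
  qed
qed

section \<open>Zeros in the parameter\<close>

text \<open>The remainder of \<open>n\<close> modulo the least period also returns \<open>x\<close>
  to itself, so minimality makes it 0.\<close>

lemma least_period_dvd:
  assumes "(g ^^ n) x = x" "1 \<le> n"
  shows "periodic_point g x" "least_period g x dvd n"
proof -
  show "periodic_point g x"
    using assms unfolding periodic_point_def by blast
  let ?p = "least_period g x"
  have p: "1 \<le> ?p" "(g ^^ ?p) x = x"
    using LeastI[of "\<lambda>m. 1 \<le> m \<and> (g ^^ m) x = x" n] assms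
    unfolding least_period_def by auto
  have "(g ^^ (n mod ?p)) x = x"
    using funpow_mod_eq[OF p(2)] assms by metis
  moreover have "n mod ?p < ?p"
    using p by simp
  ultimately have "\<not> 1 \<le> n mod ?p"
    using not_less_Least[of "n mod ?p" "\<lambda>m. 1 \<le> m \<and> (g ^^ m) x = x"]
    unfolding least_period_def by blast
  then show "?p dvd n"
    by (simp add: dvd_eq_mod_eq_0)
qed

lemma Phi_Suc: "Phi \<phi> (Suc n) c = \<phi> c (Phi \<phi> n c)"
  by (simp add: Phi_def)

lemma Phi_add_of_zero: "Phi \<phi> n c = 0 \<Longrightarrow> Phi \<phi> (n + j) c = Phi \<phi> j c"
  by (metis Phi_def add.commute comp_apply funpow_add)

lemma continuous_on_Phi:
  assumes "continuous_on (A \<times> UNIV) (\<lambda>(c, x). \<phi> c x)"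
  shows "continuous_on A (Phi \<phi> n)"
proof (induction n)
  case 0
  then show ?case by (simp add: Phi_def)
next
  case (Suc n)
  have "continuous_on A (\<lambda>c. (\<lambda>(c, x). \<phi> c x) (c, Phi \<phi> n c))"
    by (rule continuous_on_compose2[OF assms]) (auto intro!: continuous_intros Suc)
  then show ?case
    by (simp add: Phi_Suc[abs_def])
qed

section \<open>The largest zeros and the signs to their right\<close>

locale parameter_family =
  fixes \<phi> :: "real \<Rightarrow> real \<Rightarrow> real" and r :: nat
  assumes cont: "continuous_on ({0..2} \<times> UNIV) (\<lambda>(c, x). \<phi> c x)"
    and pos: "\<And>c. c \<in> {0..2} \<Longrightarrow> \<phi> c 0 > 0"
    and r_ge: "r \<ge> 2"
    and r_zero: "\<exists>c\<in>{0..<2}. (\<phi> c ^^ r) 0 = 0"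
    and r_min: "\<And>n. 2 \<le> n \<Longrightarrow> n < r \<Longrightarrow> \<not> (\<exists>c\<in>{0..<2}. (\<phi> c ^^ n) 0 = 0)"
    and neg_2: "\<And>n. n \<ge> 2 \<Longrightarrow> (\<phi> 2 ^^ n) 0 < 0"
begin

abbreviation "P \<equiv> Phi \<phi>"
abbreviation "cs \<equiv> c_star \<phi>"

lemma cont_P: "A \<subseteq> {0..2} \<Longrightarrow> continuous_on A (P n)"
  using continuous_on_Phi[OF cont] continuous_on_subset by blast

lemma P_2: "2 \<le> n \<Longrightarrow> P n 2 < 0"
  using neg_2 by (simp add: Phi_def)

lemma P_Suc_pos: "c \<in> {0..2} \<Longrightarrow> P n c = 0 \<Longrightarrow> P (Suc n) c > 0"
  using pos by (simp add: Phi_Suc)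

text \<open>The negative sign at parameter 2 persists leftwards as long as no zero is met.\<close>

lemma P_neg_right:
  assumes "2 \<le> n" "0 \<le> c" "c \<le> 2" "\<And>z. c \<le> z \<Longrightarrow> z < 2 \<Longrightarrow> P n z \<noteq> 0"
  shows "P n c < 0"
proof (rule ccontr)
  assume "\<not> P n c < 0"
  then obtain z where z: "c \<le> z" "z \<le> 2" "P n z = 0"
    using IVT2'[of "P n" 2 0 c] P_2[of n] assms cont_P[of "{c..2}" n] by auto
  with P_2[of n] assms(1) have "z \<noteq> 2"
    by auto
  with z assms(4) show False
    by auto
qed

text \<open>By continuity the zero set is compact, so its maximum exists and \<open>GREATEST\<close>
  picks it.\<close>

lemma c_star_greatest:
  assumes "Phi_zeros \<phi> l \<noteq> {}"
  shows "cs l \<in> Phi_zeros \<phi> l" "c \<in> Phi_zeros \<phi> l \<Longrightarrow> c \<le> cs l"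
proof -
  have "closed (P l -` {0} \<inter> {0..2})"
    using cont_P[of "{0..2}" l] continuous_on_closed_vimage[of "{0..2}" "P l"] by simp
  moreover have "P l -` {0} \<inter> {0..2} = Phi_zeros \<phi> l"
    by (auto simp: Phi_zeros_def)
  ultimately have "compact ({0..2} \<inter> Phi_zeros \<phi> l)"
    by (intro compact_Int_closed) auto
  moreover have "{0..2} \<inter> Phi_zeros \<phi> l = Phi_zeros \<phi> l"
    by (auto simp: Phi_zeros_def)
  ultimately obtain m where m: "m \<in> Phi_zeros \<phi> l" "\<forall>c\<in>Phi_zeros \<phi> l. c \<le> m"
    using compact_attains_sup assms by metis
  then have "cs l = m"
    unfolding c_star_def by (intro Greatest_equality) auto
  with m show "cs l \<in> Phi_zeros \<phi> l" "c \<in> Phi_zeros \<phi> l \<Longrightarrow> c \<le> cs l"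
    by auto
qed

text \<open>At \<open>cs l\<close> the next iterate is \<open>\<phi> c 0 > 0\<close>, while at 2 it
  is negative; a zero lies strictly between.\<close>

lemma c_star_step:
  assumes "2 \<le> l" "Phi_zeros \<phi> l \<noteq> {}"
  shows "Phi_zeros \<phi> (Suc l) \<noteq> {}" "cs l < cs (Suc l)"
proof -
  have c: "cs l \<in> {0..2}" "P l (cs l) = 0"
    using c_star_greatest(1)[OF assms(2)] by (auto simp: Phi_zeros_def)
  have "\<exists>z. min (cs l) 2 < z \<and> z < max (cs l) 2 \<and> P (Suc l) z = 0"
    using c P_Suc_pos P_2[of "Suc l"] assms(1) by (intro zero_between cont_P) auto
  then obtain z where "cs l < z" "z \<in> Phi_zeros \<phi> (Suc l)"
    using c by (auto simp: Phi_zeros_def)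
  then show "Phi_zeros \<phi> (Suc l) \<noteq> {}" "cs l < cs (Suc l)"
    using c_star_greatest(2)[of "Suc l" z] by force+
qed

lemma Phi_zeros_nonempty: "r \<le> l \<Longrightarrow> Phi_zeros \<phi> l \<noteq> {}"
proof (induction l rule: dec_induct)
  case base
  then show ?case
    using r_zero by (fastforce simp: Phi_zeros_def Phi_def)
next
  case (step l)
  then show ?case
    using c_star_step(1) r_ge by simp
qed

lemma c_star_zero:
  assumes "r \<le> l"
  shows "cs l \<in> Phi_zeros \<phi> l" "0 \<le> cs l" "cs l < 2" "P l (cs l) = 0"
proof -
  show "cs l \<in> Phi_zeros \<phi> l"
    using c_star_greatest(1) Phi_zeros_nonempty assms by blast
  moreover from this have "cs l \<noteq> 2"
    using P_2[of l] r_ge assms by (auto simp: Phi_zeros_def)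
  ultimately show "0 \<le> cs l" "cs l < 2" "P l (cs l) = 0"
    by (auto simp: Phi_zeros_def)
qed

lemma c_star_less_Suc: "r \<le> l \<Longrightarrow> cs l < cs (Suc l)"
  using c_star_step(2) Phi_zeros_nonempty r_ge by simp

lemma c_star_less: "r \<le> l \<Longrightarrow> l < l' \<Longrightarrow> cs l < cs l'"
  by (rule less_Suc_induct[of l l' "\<lambda>i j. r \<le> i \<longrightarrow> cs i < cs j", rule_format])
    (auto intro: c_star_less_Suc order_less_trans)

lemma c_star_le: "r \<le> l \<Longrightarrow> l \<le> l' \<Longrightarrow> cs l \<le> cs l'"
  using c_star_less by (cases "l = l'") (auto simp: order_less_le)

lemma P_neg_right_of_c_star: "r \<le> l \<Longrightarrow> cs l < c \<Longrightarrow> c \<le> 2 \<Longrightarrow> P l c < 0"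
proof (rule P_neg_right)
  fix z assume "r \<le> l" "cs l < c" "c \<le> 2" "c \<le> z" "z < 2"
  then show "P l z \<noteq> 0"
    using c_star_greatest(2)[OF Phi_zeros_nonempty, of l z] c_star_zero(2)[of l]
    by (auto simp: Phi_zeros_def)
qed (use r_ge c_star_zero(2)[of l] in auto)

text \<open>Below \<open>r\<close>, minimality of \<open>r\<close> excludes zeros in
  \<open>[0,2)\<close>; from \<open>r\<close> on, \<open>c\<close> lies to the right of
  \<open>cs j\<close>.\<close>

lemma P_neg:
  assumes "r \<le> k" "cs k \<le> c" "c \<le> 2" "2 \<le> j" "j < k"
  shows "P j c < 0"
proof (cases "j < r")
  case True
  show ?thesis
  proof (rule P_neg_right)
    show "0 \<le> c"
      using assms c_star_zero(2)[of k] by simp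
    then show "P j z \<noteq> 0" if "c \<le> z" "z < 2" for z
      using r_min[of j] assms True that by (auto simp: Phi_def)
  qed (use assms in auto)
next
  case False
  then show ?thesis
    using c_star_less[of j k] assms by (intro P_neg_right_of_c_star) auto
qed

section \<open>Zeros in the gaps between consecutive \<open>cs k\<close>\<close>

lemma zeros_in_gap:
  assumes "r \<le> k" "3 \<le> k" "0 < i"
  shows "has_at_least (a_seq k (k + i)) {c \<in> {cs k<..cs (Suc k)}. P (k + i) c = 0}"
proof (cases "i = 1")
  case True
  have "a_seq k (k + i) = 1"
    using assms True by (subst a_seq.simps) auto
  moreover have "cs (Suc k) \<in> {c \<in> {cs k<..cs (Suc k)}. P (k + i) c = 0}"
    using c_star_zero(4)[of "Suc k"] c_star_less_Suc[of k] assms True by auto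
  ultimately show ?thesis
    using has_at_least_1 by metis
next
  case False
  then obtain l where l: "i = 1 + l" "0 < l"
    using assms(3) by (metis One_nat_def Suc_lessI less_imp_add_positive)
  let ?u = "cs (Suc k)" and ?v = "cs k"
  have lt: "?v < ?u"
    using c_star_less_Suc assms by blast
  have uv: "0 \<le> ?v" "?u < 2"
    using c_star_zero[of k] c_star_zero[of "Suc k"] assms by auto
  have neg: "P (Suc n + s) x < 0" if "x \<in> {?v<..?u}" "P n x = 0" "s \<in> {1..k - 1}" for n x s
  proof -
    have "P (Suc n + s) x = P (Suc s) x"
      using Phi_add_of_zero[OF that(2), of "Suc s"] by simp
    moreover have "P (Suc s) x < 0"
    proof (cases "Suc s = k")
      \<comment> \<open>Index \<open>k\<close> is where \<open>x\<close> must lie strictly to the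
        right of \<open>cs k\<close>.\<close>
      case True
      then show ?thesis
        using P_neg_right_of_c_star[of k x] assms that uv by auto
    qed (use P_neg[of k x "Suc s"] assms that uv in auto)
    ultimately show ?thesis by simp
  qed
  \<comment> \<open>At \<open>cs k\<close> the orbit restarts at time \<open>k\<close>, and only the
    indices 2 to \<open>k - 1\<close> are negative: \<open>k - 2\<close> values instead of
    \<open>k - 1\<close>.\<close>
  have left: "P (k + 1 + s) ?v < 0" if "s \<in> {1..k - 2}" for s
    using Phi_add_of_zero[OF c_star_zero(4)[OF assms(1)], of "Suc s"]
      P_neg[of k ?v "Suc s"] assms that uv lt by auto
  have "has_at_least (zero_count (k - 1) (k - 2) l)
      {x \<in> {min ?u ?v<..<max ?u ?v}. P (k + 1 + l) x = 0}"
  proof (rule zeros_between)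
    show "continuous_on {?v..?u} (P n)" for n
      using uv by (intro cont_P) auto
    show "P (k + 1) ?u = 0"
      using c_star_zero(4)[of "Suc k"] assms by simp
  qed (use neg left P_Suc_pos lt uv in auto)
  moreover have "zero_count (k - 1) (k - 2) l = a_seq k (k + i)"
    using a_seq_eq_zero_count[of k l] assms l by (simp add: add.assoc)
  ultimately show ?thesis
    using lt l by (auto elim!: has_at_least_mono simp: add.assoc)
qed

lemma zeros_in_closed_gap:
  assumes "r \<le> k" "3 \<le> k"
  shows "has_at_least (a_seq k (k + i)) {c \<in> {cs k..cs (Suc k)}. P (k + i) c = 0}"
proof (cases "i = 0")
  case True
  have "a_seq k (k + i) = 1"
    using True by (subst a_seq.simps) auto
  moreover have "cs k \<in> {c \<in> {cs k..cs (Suc k)}. P (k + i) c = 0}"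
    using c_star_zero(4)[of k] c_star_less_Suc[of k] assms True by auto
  ultimately show ?thesis
    using has_at_least_1 by metis
next
  case False
  then show ?thesis
    using zeros_in_gap[of k i] assms by (auto elim!: has_at_least_mono)
qed

text \<open>The gaps are taken open on the left, so they are disjoint for different \<open>k\<close>
  and their counts add up.\<close>

lemma N_seq_zeros:
  assumes "r \<le> s" "3 \<le> s" "s \<le> n"
  shows "has_at_least (N_seq s n) (Phi_zeros \<phi> n)"
proof (cases "n = s \<or> n = s + 1")
  \<comment> \<open>The two starting values 1 are witnessed by \<open>cs n\<close> itself; at
    \<open>n = s\<close> the sum over gaps would be empty.\<close>
  case True
  then show ?thesis
    using has_at_least_1 c_star_zero(1)[of n] assms by (simp add: N_seq_def)
next
  case False
  let ?A = "\<lambda>k. {c \<in> {cs k<..cs (Suc k)}. P n c = 0}"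
  have "has_at_least (\<Sum>k\<in>{s..<n}. a_seq k n) (\<Union>k\<in>{s..<n}. ?A k)"
  proof (rule has_at_least_UN)
    show "has_at_least (a_seq k n) (?A k)" if "k \<in> {s..<n}" for k
      using zeros_in_gap[of k "n - k"] that assms by auto
    have "?A i \<inter> ?A j = {}" if "s \<le> i" "i < j" for i j
      using c_star_le[of "Suc i" j] that assms by fastforce
    then show "?A i \<inter> ?A j = {}" if "i \<in> {s..<n}" "j \<in> {s..<n}" "i \<noteq> j" for i j
      using that by (cases i j rule: linorder_cases) auto
  qed simp
  then have "has_at_least (N_seq s n) (\<Union>k\<in>{s..<n}. ?A k)"
    using False by (simp add: N_seq_def)
  moreover have "?A k \<subseteq> Phi_zeros \<phi> n" if "s \<le> k" for k
    using c_star_zero[of k] c_star_zero[of "Suc k"] assms that by (auto simp: Phi_zeros_def)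
  ultimately show ?thesis
    by (elim has_at_least_mono) fastforce
qed

end

theorem theorem1:
  fixes \<phi> :: "real \<Rightarrow> real \<Rightarrow> real" and r rhat :: nat
  assumes cont: "continuous_on ({0..2} \<times> UNIV) (\<lambda>(c, x). \<phi> c x)"
    and a: "\<And>c. c \<in> {0..2} \<Longrightarrow> \<phi> c 0 > 0"
    and b_ge: "r \<ge> 2"
    and b_ex: "\<exists>c\<in>{0..<2}. (\<phi> c ^^ r) 0 = 0"
    and b_min: "\<And>n. 2 \<le> n \<Longrightarrow> n < r \<Longrightarrow> \<not> (\<exists>c\<in>{0..<2}. (\<phi> c ^^ n) 0 = 0)"
    and c: "\<And>n. n \<ge> 2 \<Longrightarrow> (\<phi> 2 ^^ n) 0 < 0"
    and rhat: "rhat = max 3 r"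
  shows
    "((\<forall>l\<ge>r. c_star \<phi> l \<in> Phi_zeros \<phi> l \<and> (\<forall>c\<in>Phi_zeros \<phi> l. c \<le> c_star \<phi> l)) \<and>
      0 \<le> c_star \<phi> r \<and>
      (\<forall>l\<ge>r. c_star \<phi> l < c_star \<phi> (l + 1) \<and> c_star \<phi> l < 2)) \<and>
     (\<forall>k\<ge>rhat. \<forall>i. has_at_least (a_seq k (k + i))
        {c \<in> {c_star \<phi> k..c_star \<phi> (k + 1)}. (\<phi> c ^^ (k + i)) 0 = 0}) \<and>
     ((\<forall>n\<ge>rhat. has_at_least (N_seq rhat n)
        {c \<in> {0..2}. periodic_point (\<phi> c) 0 \<and> least_period (\<phi> c) 0 dvd n}) \<and>
      liminf (\<lambda>n. ereal (ln (real (N_seq rhat n)) / real n)) \<ge> ereal (ln 2))"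
proof -
  interpret parameter_family \<phi> r
    using assms by unfold_locales auto
  have s: "r \<le> rhat" "3 \<le> rhat"
    using rhat by auto
  have "c_star \<phi> l \<in> Phi_zeros \<phi> l \<and> (\<forall>c\<in>Phi_zeros \<phi> l. c \<le> c_star \<phi> l)" if "r \<le> l" for l
    using c_star_greatest Phi_zeros_nonempty that by blast
  moreover have "0 \<le> c_star \<phi> r"
    using c_star_zero(2) by simp
  moreover have "c_star \<phi> l < c_star \<phi> (l + 1) \<and> c_star \<phi> l < 2" if "r \<le> l" for l
    using c_star_less_Suc c_star_zero(3) that by simp
  moreover have "has_at_least (a_seq k (k + i))
      {c \<in> {c_star \<phi> k..c_star \<phi> (k + 1)}. (\<phi> c ^^ (k + i)) 0 = 0}" if "rhat \<le> k" for k i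
    using zeros_in_closed_gap[of k i] s that by (simp add: Phi_def)
  moreover have "has_at_least (N_seq rhat n)
      {c \<in> {0..2}. periodic_point (\<phi> c) 0 \<and> least_period (\<phi> c) 0 dvd n}" if "rhat \<le> n" for n
    using N_seq_zeros[OF s that]
  proof (rule has_at_least_mono)
    show "Phi_zeros \<phi> n \<subseteq> {c \<in> {0..2}. periodic_point (\<phi> c) 0 \<and> least_period (\<phi> c) 0 dvd n}"
      using least_period_dvd[of n _ 0] s that by (auto simp: Phi_zeros_def Phi_def)
  qed
  ultimately show ?thesis
    using liminf_N_seq[OF s(2)] by blast
qed

end
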